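(* Let $A\subset\mathbb{R}^n$ be a nonempty compact set, let $N\ge 1$, and let $f:[0,\infty)\to[0,\infty)$ be continuous and strictly monotonically decreasing. If an $N$-point configuration $C$ in $\mathbb{R}^n$ is a locally optimal solution of the maximal polarization problem $\sup_{C} P_{f,A}(C)$ (the supremum over all $N$-point configurations in $\mathbb{R}^n$), then $$C\subset \operatorname{conv}\bigl(\operatorname{Dark}_A(C)\bigr).$$
   Context: An $N$-point configuration is a multiset $C=\{c_1,\dots,c_N\}$ of $N$ points of $\mathbb{R}^n$ (repetitions allowed). For $p\in\mathbb{R}^n$ put $U(p,C)=\sum_{c\in C} f(\|p-c\|)$ (summing with multiplicity; $\|\cdot\|$ is the Euclidean norm), and let $P_{f,A}(C)=\inf_{p\in A}U(p,C)$ be the polarization of $C$. The set of darkest points is $\operatorname{Dark}_A(C)=\{p\in A : U(p,C)=P_{f,A}(C)\}$. The configuration $C=\{c_1,\dots,c_N\}$ is locally optimal if there is $\delta>0$ such that $P_{f,A}(C')\le P_{f,A}(C)$ for every configuration $C'=\{c_1',\dots,c_N'\}$ with $\|c_i'-c_i\|<\delta$ for all $i$. The inclusion $C\subset X$ means that every point of $C$ lies in $X$. *)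

theory Defs
  imports "HOL-Analysis.Analysis" "HOL-Library.Multiset"
begin

text \<open>A configuration of \<open>N\<close> points is a multiset \<open>C\<close> with \<open>size C = N\<close>. The potential
  \<open>f\<close> has domain \<open>[0, \<infinity>)\<close>; its values at negative arguments are never used.\<close>

definition potential :: "(real \<Rightarrow> real) \<Rightarrow> 'a::real_normed_vector \<Rightarrow> 'a multiset \<Rightarrow> real" where
  "potential f p C = (\<Sum>c\<in>#C. f (norm (p - c)))"

definition polarization ::
  "(real \<Rightarrow> real) \<Rightarrow> 'a::real_normed_vector set \<Rightarrow> 'a multiset \<Rightarrow> real" where
  "polarization f A C = (INF p\<in>A. potential f p C)"

definition Dark ::
  "(real \<Rightarrow> real) \<Rightarrow> 'a::real_normed_vector set \<Rightarrow> 'a multiset \<Rightarrow> 'a set" where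
  "Dark f A C = {p \<in> A. potential f p C = polarization f A C}"

text \<open>\<^const>\<open>rel_mset\<close> pairs the points of the two multisets one to one: there are enumerations
  \<open>c\<^sub>1, \<dots>, c\<^sub>N\<close> of \<open>C\<close> and \<open>c\<^sub>1', \<dots>, c\<^sub>N'\<close> of \<open>C'\<close> of the same length
  whose corresponding entries are at distance less than \<open>\<delta>\<close>.\<close>

definition locally_optimal ::
  "(real \<Rightarrow> real) \<Rightarrow> 'a::real_normed_vector set \<Rightarrow> 'a multiset \<Rightarrow> bool" where
  "locally_optimal f A C \<longleftrightarrow>
     (\<exists>\<delta>>0. \<forall>C'. rel_mset (\<lambda>c c'. norm (c' - c) < \<delta>) C C' \<longrightarrow>
        polarization f A C' \<le> polarization f A C)"

end

theory Submission
  imports Defs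
begin

text \<open>If \<open>c \<in> C\<close> lies outside the convex hull of the darkest points, a hyperplane strictly separates
  the two. Moving (one copy of) \<open>c\<close> slightly towards the hyperplane brings it closer to every point
  beyond the hyperplane, so the potential strictly increases there. The points of \<open>A\<close> on the near side
  form a compact set without darkest points, so there the potential exceeds the polarization by a fixed
  margin, which survives a small move. Hence the polarization increases.\<close>

lemma potential_add_mset:
  "potential f p (add_mset c C) = f (norm (p - c)) + potential f p C"
  by (simp add: potential_def)

lemma continuous_on_potential:
  assumes "continuous_on {0..} f"
  shows "continuous_on S (\<lambda>p. potential f p C)"
proof (induction C)
  case empty
  then show ?case by (simp add: potential_def)
next
  case (add c C)
  have "continuous_on S (\<lambda>p. f (norm (p - c)))"
    by (rule continuous_on_compose2[OF assms]) (auto intro!: continuous_intros)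
  with add show ?case
    unfolding potential_add_mset by (intro continuous_intros)
qed

text \<open>Compactness of \<open>A\<close> and continuity of the potential turn the infimum into an
  attained minimum. In \<open>Dark_nonempty\<close> the point \<open>p\<close> serves as witness
  that \<open>A\<close> is nonempty.\<close>

lemma
  assumes "compact A" and "continuous_on {0..} f" and "p \<in> A"
  shows Dark_nonempty: "Dark f A C \<noteq> {}"
    and polarization_le: "polarization f A C \<le> potential f p C"
proof -
  obtain q where q: "q \<in> A" "\<And>x. x \<in> A \<Longrightarrow> potential f q C \<le> potential f x C"
    using continuous_attains_inf[OF assms(1) _ continuous_on_potential[OF assms(2)]] assms(3)
    by blast
  have "polarization f A C = potential f q C"
    unfolding polarization_def using q by (intro cInf_eq_minimum) auto
  with q assms(3) show "Dark f A C \<noteq> {}" "polarization f A C \<le> potential f p C"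
    by (auto simp: Dark_def)
qed

lemma compact_Dark:
  assumes "compact A" and "continuous_on {0..} f"
  shows "compact (Dark f A C)"
proof -
  have "closed {p. potential f p C = polarization f A C}"
    by (intro closed_Collect_eq continuous_on_potential assms continuous_intros)
  moreover have "Dark f A C = A \<inter> {p. potential f p C = polarization f A C}"
    by (auto simp: Dark_def)
  ultimately show ?thesis
    using assms(1) by (simp add: compact_Int_closed)
qed

text \<open>The squared distance is a quadratic polynomial in \<open>t\<close> with slope
  \<open>- 2 * (a \<bullet> (p - c))\<close> at 0. It stays below its initial value until its second
  crossing of that value, which is where the bound on \<open>t\<close> becomes an equality.\<close>

lemma norm_diff_move_less:
  fixes a p c :: "'a::real_inner"
  assumes "0 < t" and "t * (norm a)\<^sup>2 < 2 * (a \<bullet> (p - c))"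
  shows "norm (p - (c + t *\<^sub>R a)) < norm (p - c)"
proof -
  have "(norm (p - (c + t *\<^sub>R a)))\<^sup>2
      = (norm (p - c))\<^sup>2 + t * (t * (norm a)\<^sup>2 - 2 * (a \<bullet> (p - c)))"
    unfolding power2_norm_eq_inner
    by (simp add: inner_simps inner_commute algebra_simps power2_eq_square)
  also have "\<dots> < (norm (p - c))\<^sup>2"
    using assms by (simp add: mult_pos_neg)
  finally show ?thesis
    by (rule power_less_imp_less_base) simp
qed

lemma rel_mset_move:
  fixes c d :: "'a::real_normed_vector"
  assumes "norm (d - c) < \<delta>"
  shows "rel_mset (\<lambda>c c'. norm (c' - c) < \<delta>) (add_mset c B) (add_mset d B)"
proof -
  have "0 < \<delta>"
    using assms norm_ge_zero[of "d - c"] by linarith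
  then have "rel_mset (\<lambda>c c'. norm (c' - c) < \<delta>) B B"
    by (intro multiset.rel_refl) simp
  with assms show ?thesis
    by (rule rel_mset_Plus)
qed

text \<open>One \<open>\<eta>\<close> serves all \<open>p\<close> in \<open>S\<close>: the distances
  involved stay in a bounded interval, on which \<open>f\<close> is uniformly continuous.\<close>

lemma exists_uniform_move:
  fixes c :: "'a::real_normed_vector" and f :: "real \<Rightarrow> real"
  assumes f: "continuous_on {0..} f" and "compact S" and "0 < \<epsilon>"
  shows "\<exists>\<eta>>0. \<forall>p\<in>S. \<forall>d. norm (d - c) < \<eta> \<longrightarrow> \<bar>f (norm (p - d)) - f (norm (p - c))\<bar> < \<epsilon>"
proof -
  obtain R where R: "\<And>p. p \<in> S \<Longrightarrow> norm p \<le> R"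
    using compact_imp_bounded[OF \<open>compact S\<close>] by (auto simp: bounded_iff)
  \<comment> \<open>The summand 1 leaves room for moving \<open>c\<close> by less than 1, hence the
    cap \<open>min \<eta> 1\<close> below.\<close>
  let ?M = "R + norm c + 1"
  have "uniformly_continuous_on {0..?M} f"
    by (intro compact_uniformly_continuous continuous_on_subset[OF f]) auto
  then obtain \<eta> where \<eta>: "\<eta> > 0"
      "\<And>x y. x \<in> {0..?M} \<Longrightarrow> y \<in> {0..?M} \<Longrightarrow> dist y x < \<eta> \<Longrightarrow> dist (f y) (f x) < \<epsilon>"
    using \<open>0 < \<epsilon>\<close> unfolding uniformly_continuous_on_def by metis
  have "\<bar>f (norm (p - d)) - f (norm (p - c))\<bar> < \<epsilon>"
    if "p \<in> S" and d: "norm (d - c) < min \<eta> 1" for p d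
  proof -
    have close: "\<bar>norm (p - d) - norm (p - c)\<bar> \<le> norm (d - c)"
      using norm_triangle_ineq3[of "p - d" "p - c"] by (simp add: norm_minus_commute)
    moreover have "norm (p - c) \<le> R + norm c"
      using norm_triangle_ineq4[of p c] R[OF \<open>p \<in> S\<close>] by linarith
    ultimately have "norm (p - c) \<in> {0..?M}" "norm (p - d) \<in> {0..?M}"
        "dist (norm (p - d)) (norm (p - c)) < \<eta>"
      using d by (auto simp: dist_real_def)
    then show ?thesis
      using \<eta>(2) by (simp add: dist_real_def)
  qed
  with \<open>\<eta> > 0\<close> show ?thesis
    by (intro exI[of _ "min \<eta> 1"]) auto
qed

lemma polarization_improvable:
  fixes A :: "'a::euclidean_space set"
  assumes "A \<noteq> {}" and "compact A"
    and f: "continuous_on {0..} f" "strict_antimono_on {0..} f"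
    and c: "c \<notin> convex hull (Dark f A (add_mset c B))" and "0 < \<delta>"
  shows "\<exists>d. norm (d - c) < \<delta> \<and>
    polarization f A (add_mset c B) < polarization f A (add_mset d B)"
proof -
  let ?C = "add_mset c B" and ?K = "convex hull (Dark f A (add_mset c B))"
  have "closed ?K"
    by (intro compact_imp_closed compact_convex_hull compact_Dark \<open>compact A\<close> f)
  then obtain a b where ab: "a \<bullet> c < b" "\<And>x. x \<in> ?K \<Longrightarrow> b < a \<bullet> x"
    using separating_hyperplane_closed_point[of ?K c] c by auto
  \<comment> \<open>For \<open>a = 0\<close> the separation would give \<open>0 < b\<close> at
    \<open>c\<close> and \<open>b < 0\<close> at any darkest point.\<close>
  have "a \<noteq> 0"
    using ab Dark_nonempty[OF \<open>compact A\<close> f(1), of _ ?C] \<open>A \<noteq> {}\<close>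
    by (metis all_not_in_conv hull_inc inner_zero_left not_less_iff_gr_or_eq)
  define S where "S = A \<inter> {p. a \<bullet> p \<le> b}"
  have "compact S"
    unfolding S_def by (intro compact_Int_closed \<open>compact A\<close> closed_halfspace_le)
  have "\<exists>\<epsilon>>0. \<forall>p\<in>S. polarization f A ?C + \<epsilon> \<le> potential f p ?C"
  proof (cases "S = {}")
    case True
    then show ?thesis by (auto intro: exI[of _ 1])
  next
    case False
    then obtain q where q: "q \<in> S" "\<And>p. p \<in> S \<Longrightarrow> potential f q ?C \<le> potential f p ?C"
      using continuous_attains_inf[OF \<open>compact S\<close> _ continuous_on_potential[OF f(1)]] by blast
    have "q \<notin> Dark f A ?C"
      using ab(2)[OF hull_inc, of q] q(1) by (auto simp: S_def)
    moreover have "q \<in> A"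
      using q(1) by (simp add: S_def)
    ultimately have "polarization f A ?C < potential f q ?C"
      using polarization_le[OF \<open>compact A\<close> f(1), of q ?C] by (auto simp: Dark_def)
    then show ?thesis
      using q(2) by (intro exI[of _ "potential f q ?C - polarization f A ?C"]) auto
  qed
  then obtain \<epsilon> where \<epsilon>: "\<epsilon> > 0" "\<And>p. p \<in> S \<Longrightarrow> polarization f A ?C + \<epsilon> \<le> potential f p ?C"
    by blast
  obtain \<eta> where \<eta>: "\<eta> > 0"
      "\<And>p d. p \<in> S \<Longrightarrow> norm (d - c) < \<eta> \<Longrightarrow> \<bar>f (norm (p - d)) - f (norm (p - c))\<bar> < \<epsilon>"
    using exists_uniform_move[OF f(1) \<open>compact S\<close> \<epsilon>(1)] by blast
  \<comment> \<open>The first bound gives \<open>norm (d - c)\<close> at most half of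
    \<open>min \<delta> \<eta>\<close>, so strictly less than it. The second keeps \<open>d\<close>
    from passing the hyperplane: for \<open>p\<close> beyond it, \<open>t * (norm a)\<^sup>2 \<le> b
    - a \<bullet> c < a \<bullet> (p - c)\<close>, and this last quantity is positive.\<close>
  define t where "t = min (min \<delta> \<eta> / (2 * norm a)) ((b - a \<bullet> c) / (norm a)\<^sup>2)"
  define d where "d = c + t *\<^sub>R a"
  have "0 < t"
    using \<open>a \<noteq> 0\<close> \<open>0 < \<delta>\<close> \<open>0 < \<eta>\<close> ab(1) by (simp add: t_def)
  have "t * norm a \<le> min \<delta> \<eta> / (2 * norm a) * norm a"
    by (intro mult_right_mono) (simp_all add: t_def)
  then have "norm (d - c) < min \<delta> \<eta>"
    using \<open>a \<noteq> 0\<close> \<open>0 < t\<close> \<open>0 < \<delta>\<close> \<open>0 < \<eta>\<close> by (simp add: d_def)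
  have "t * (norm a)\<^sup>2 \<le> (b - a \<bullet> c) / (norm a)\<^sup>2 * (norm a)\<^sup>2"
    by (intro mult_right_mono) (simp_all add: t_def)
  then have ta: "t * (norm a)\<^sup>2 \<le> b - a \<bullet> c"
    using \<open>a \<noteq> 0\<close> by simp
  have improved: "polarization f A ?C < potential f p (add_mset d B)" if "p \<in> A" for p
  proof (cases "p \<in> S")
    case True
    \<comment> \<open>Only the term of the moved point changes, and by less than the margin
      \<open>\<epsilon>\<close>.\<close>
    then show ?thesis
      using \<epsilon>(2)[of p] \<eta>(2)[of p d] \<open>norm (d - c) < min \<delta> \<eta>\<close>
      by (simp add: potential_add_mset)
  next
    case False
    then have "b < a \<bullet> p"
      using that by (simp add: S_def)
    then have "norm (p - d) < norm (p - c)"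
      unfolding d_def using \<open>0 < t\<close> ta ab(1)
      by (intro norm_diff_move_less) (auto simp: inner_diff_right)
    then have "f (norm (p - c)) < f (norm (p - d))"
      using f(2) by (auto simp: monotone_on_def)
    then show ?thesis
      using polarization_le[OF \<open>compact A\<close> f(1) that, of ?C] by (simp add: potential_add_mset)
  qed
  \<comment> \<open>A strict inequality at every point need not survive an infimum; it does here
    because the new infimum is attained at \<open>q\<close>.\<close>
  obtain q where "q \<in> Dark f A (add_mset d B)"
    using Dark_nonempty[OF \<open>compact A\<close> f(1)] \<open>A \<noteq> {}\<close> by blast
  then have "polarization f A ?C < polarization f A (add_mset d B)"
    using improved[of q] by (simp add: Dark_def)
  with \<open>norm (d - c) < min \<delta> \<eta>\<close> show ?thesis
    by auto
qed

theorem theorem2p1: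
  fixes A :: "(real ^ 'n) set" and N :: nat and f :: "real \<Rightarrow> real"
    and C :: "(real ^ 'n) multiset"
  assumes "A \<noteq> {}" and "compact A"
    and "N \<ge> 1"
    and "\<And>r. r \<ge> 0 \<Longrightarrow> f r \<ge> 0"
    and "continuous_on {0..} f"
    and "strict_antimono_on {0..} f"
    and "size C = N"
    and "locally_optimal f A C"
  shows "set_mset C \<subseteq> convex hull (Dark f A C)"
proof
  fix c assume "c \<in># C"
  \<comment> \<open>A single copy of \<open>c\<close> is split off; further copies may remain in
    \<open>B\<close> and stay fixed.\<close>
  then obtain B where C: "C = add_mset c B"
    by (rule mset_add)
  obtain \<delta> where \<delta>: "\<delta> > 0"
      "\<And>C'. rel_mset (\<lambda>c c'. norm (c' - c) < \<delta>) C C' \<Longrightarrow> polarization f A C' \<le> polarization f A C"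
    using assms(8) by (auto simp: locally_optimal_def)
  show "c \<in> convex hull (Dark f A C)"
  proof (rule ccontr)
    assume "c \<notin> convex hull (Dark f A C)"
    then obtain d where "norm (d - c) < \<delta>"
        "polarization f A (add_mset c B) < polarization f A (add_mset d B)"
      using polarization_improvable[OF assms(1,2,5,6) _ \<delta>(1)] unfolding C by blast
    with \<delta>(2)[unfolded C, OF rel_mset_move] show False
      by (meson not_less)
  qed
qed

end
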